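(* Let $\gamma:S^1\rightarrow\mathbb{R}^2$ be a Jordan curve with exactly one special corner. Then there exist $\theta_0\in\mathbb{R}$ and $\epsilon>0$ such that for all $\theta\in(\theta_0-\epsilon,\theta_0+\epsilon)$, there is no special corner of $\gamma$ of angle $\theta$.
   Context: A Jordan curve is a continuous injective map $\gamma:S^1\to\mathbb{R}^2$; no regularity is assumed. Its image is denoted $\operatorname{im}(\gamma)$. A line of angle $\theta$ ($\theta\in\mathbb{R}$) is a line in $\mathbb{R}^2$ of the form $x\sin\theta-y\cos\theta=\text{constant}$, i.e. a line making angle $\theta$ with the $x$-axis in the anti-clockwise sense. A special corner of $\gamma$ of angle $\theta$ is a point $p\in \operatorname{im}(\gamma)$ such that both the line of angle $\theta$ through $p$ and the line of angle $\theta+\frac{\pi}{2}$ through $p$ intersect $\operatorname{im}(\gamma)$ only at $p$. A point $p$ is a special corner of $\gamma$ if it is a special corner of $\gamma$ of at least one angle $\theta$. "Exactly one special corner" means exactly one point $p$ is a special corner of $\gamma$ (it may be a special corner of several angles). *)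

theory Defs
  imports "HOL-Analysis.Analysis"
begin

text \<open>The circle is the unit circle in the complex plane. A map on it is a total function on
  \<^typ>\<open>complex\<close> whose values off the circle are irrelevant.\<close>

abbreviation unit_circle :: "complex set" where
  "unit_circle \<equiv> sphere 0 1"

definition jordan_curve :: "(complex \<Rightarrow> real ^ 2) \<Rightarrow> bool" where
  "jordan_curve \<gamma> \<longleftrightarrow> continuous_on unit_circle \<gamma> \<and> inj_on \<gamma> unit_circle"

definition curve_image :: "(complex \<Rightarrow> real ^ 2) \<Rightarrow> (real ^ 2) set" where
  "curve_image \<gamma> = \<gamma> ` unit_circle"

definition line_of_angle :: "real \<Rightarrow> real \<Rightarrow> (real ^ 2) set" where
  "line_of_angle \<theta> c = {q. q $ 1 * sin \<theta> - q $ 2 * cos \<theta> = c}"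

definition line_through :: "real \<Rightarrow> real ^ 2 \<Rightarrow> (real ^ 2) set" where
  "line_through \<theta> p = line_of_angle \<theta> (p $ 1 * sin \<theta> - p $ 2 * cos \<theta>)"

lemma line_of_angle_eq_line_through_iff:
  "line_of_angle \<theta> c = line_through \<theta> p \<longleftrightarrow> p \<in> line_of_angle \<theta> c"
  by (auto simp: line_through_def line_of_angle_def)

definition special_corner_of_angle :: "(complex \<Rightarrow> real ^ 2) \<Rightarrow> real \<Rightarrow> real ^ 2 \<Rightarrow> bool" where
  "special_corner_of_angle \<gamma> \<theta> p \<longleftrightarrow>
     p \<in> curve_image \<gamma> \<and>
     line_through \<theta> p \<inter> curve_image \<gamma> = {p} \<and>
     line_through (\<theta> + pi / 2) p \<inter> curve_image \<gamma> = {p}"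

definition special_corner :: "(complex \<Rightarrow> real ^ 2) \<Rightarrow> real ^ 2 \<Rightarrow> bool" where
  "special_corner \<gamma> p \<longleftrightarrow> (\<exists>\<theta>. special_corner_of_angle \<gamma> \<theta> p)"

end

theory Submission
  imports Defs
begin

text \<open>Let \<open>p\<close> be the only special corner, so that no other point can be a special corner of any
  angle. Removing a point from a circle leaves it connected, hence so is the curve without \<open>p\<close>.
  If two points \<open>a\<close>, \<open>b\<close> of the curve lie strictly on opposite sides of the line of angle \<open>\<theta>\<close>
  through \<open>p\<close>, then this line meets the curve away from \<open>p\<close>, and \<open>p\<close> is not a special corner of
  angle \<open>\<theta>\<close>. For fixed \<open>a\<close> and \<open>b\<close> this condition on \<open>\<theta>\<close> is open. It is satisfied by some
  \<open>\<theta>\<close> as soon as \<open>p\<close>, \<open>a\<close>, \<open>b\<close> are not collinear: the line through \<open>p\<close> that bisects the segment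
  from \<open>a\<close> to \<open>b\<close> separates them. Such \<open>a\<close> and \<open>b\<close> exist because a circle does not embed into a line,
  which is the one-dimensional Borsuk--Ulam theorem.\<close>

definition cross2 :: "real ^ 2 \<Rightarrow> real ^ 2 \<Rightarrow> real" where
  "cross2 u v = u $ 1 * v $ 2 - u $ 2 * v $ 1"

text \<open>A vector of the line of angle \<open>\<theta>\<close> through the origin has offset zero; in general the offset
  is the signed distance to that line.\<close>
definition offset :: "real \<Rightarrow> real ^ 2 \<Rightarrow> real" where
  "offset \<theta> v = v $ 1 * sin \<theta> - v $ 2 * cos \<theta>"

lemma mem_line_through_iff: "q \<in> line_through \<theta> p \<longleftrightarrow> offset \<theta> (q - p) = 0"
  by (auto simp: line_through_def line_of_angle_def offset_def algebra_simps)

lemma continuous_on_offset: "continuous_on S (\<lambda>q. offset \<theta> (q - p))"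
  unfolding offset_def by (intro continuous_intros)

text \<open>The odd function \<open>g z - g (- z)\<close> takes opposite values at \<open>1\<close> and \<open>- 1\<close>, hence vanishes
  somewhere on the connected circle.\<close>
lemma antipodal_equal_values:
  fixes g :: "complex \<Rightarrow> real"
  assumes "continuous_on unit_circle g"
  obtains z where "z \<in> unit_circle" "g z = g (- z)"
proof -
  define h where "h z = g z - g (- z)" for z
  have "continuous_on unit_circle (\<lambda>z. g (- z))"
    by (rule continuous_on_compose2[OF assms]) (auto intro!: continuous_intros)
  then have "continuous_on unit_circle h"
    unfolding h_def using assms by (intro continuous_intros)
  then have "connected (h ` unit_circle)"
    by (intro connected_continuous_image connected_sphere) auto
  moreover have "h 1 \<in> h ` unit_circle" "h (- 1) \<in> h ` unit_circle"
    by auto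
  moreover have "h (- 1) = - h 1"
    by (simp add: h_def)
  ultimately have "0 \<in> h ` unit_circle"
    unfolding connected_iff_interval by (metis neg_0_le_iff_le neg_le_0_iff_le linear)
  then show thesis
    using that by (auto simp: h_def)
qed

lemma connected_punctured_unit_circle:
  assumes "b \<in> unit_circle"
  shows "connected (unit_circle - {b})"
proof -
  have "(unit_circle - {b}) homeomorphic {x :: complex. 1 \<bullet> x = 0}"
    using assms by (intro homeomorphic_punctured_sphere_hyperplane) auto
  moreover have "connected {x :: complex. 1 \<bullet> x = 0}"
    by (intro convex_connected convex_hyperplane)
  ultimately show ?thesis
    by (simp add: homeomorphic_connectedness)
qed

lemma connected_punctured_jordan_curve:
  assumes "jordan_curve \<gamma>" "p \<in> curve_image \<gamma>"
  shows "connected (curve_image \<gamma> - {p})"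
proof -
  obtain b where b: "b \<in> unit_circle" "p = \<gamma> b"
    using assms(2) by (auto simp: curve_image_def)
  have "curve_image \<gamma> - {p} = \<gamma> ` (unit_circle - {b})"
    using assms(1) b inj_on_image_set_diff[of \<gamma> unit_circle unit_circle "{b}"]
    by (auto simp: curve_image_def jordan_curve_def)
  moreover have "continuous_on (unit_circle - {b}) \<gamma>"
    using assms(1) by (auto simp: jordan_curve_def intro: continuous_on_subset)
  ultimately show ?thesis
    using connected_punctured_unit_circle[OF b(1)] connected_continuous_image by metis
qed

text \<open>If all of the curve lay on one line with direction \<open>w\<close>, the coordinate along \<open>w\<close> would be an
  injective continuous function on the circle.\<close>
lemma jordan_curve_not_collinear:
  assumes "jordan_curve \<gamma>"
  obtains a b where "a \<in> curve_image \<gamma>" "b \<in> curve_image \<gamma>" "cross2 (a - p) (b - p) \<noteq> 0"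
proof (rule ccontr)
  assume "\<not> thesis"
  with that have collinear: "\<And>a b. a \<in> curve_image \<gamma> \<Longrightarrow> b \<in> curve_image \<gamma> \<Longrightarrow> cross2 (a - p) (b - p) = 0"
    by blast
  have inj: "inj_on \<gamma> unit_circle" and cont: "continuous_on unit_circle \<gamma>"
    using assms by (auto simp: jordan_curve_def)
  have "\<gamma> 1 \<noteq> \<gamma> (- 1)"
    using inj_onD[OF inj, of 1 "- 1"] by auto
  then obtain a where a: "a \<in> curve_image \<gamma>" "a \<noteq> p"
    unfolding curve_image_def by (metis image_eqI mem_sphere_0 norm_minus_cancel norm_one)
  define w where "w = a - p"
  have "continuous_on unit_circle (\<lambda>z. \<gamma> z \<bullet> w)"
    using cont by (intro continuous_intros)
  then obtain z where z: "z \<in> unit_circle" "\<gamma> z \<bullet> w = \<gamma> (- z) \<bullet> w"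
    by (rule antipodal_equal_values)
  define d where "d = \<gamma> z - \<gamma> (- z)"
  have "cross2 (\<gamma> z - p) w = 0" "cross2 (\<gamma> (- z) - p) w = 0"
    using z(1) a(1) by (auto simp: w_def curve_image_def intro!: collinear)
  then have "cross2 d w = 0"
    by (simp add: cross2_def d_def algebra_simps)
  moreover have "d \<bullet> w = 0"
    using z(2) by (simp add: d_def inner_diff_left)
  moreover have "(d \<bullet> d) * (w \<bullet> w) = (d \<bullet> w)\<^sup>2 + (cross2 d w)\<^sup>2"
    by (simp add: inner_vec_def sum_2 cross2_def power2_eq_square algebra_simps)
  ultimately have "d = 0"
    using a(2) by (simp add: w_def)
  then have "z = - z"
    using z(1) inj_onD[OF inj, of z "- z"] by (simp add: d_def)
  then show False
    using z(1) by auto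
qed

lemma offset_polar:
  assumes "w $ 1 = r * cos \<theta>" "w $ 2 = r * sin \<theta>"
  shows "r * offset \<theta> v = cross2 v w"
  by (simp add: assms offset_def cross2_def algebra_simps)

text \<open>The direction of \<open>u + v\<close> works, since \<open>cross2 u (u + v)\<close> and \<open>cross2 v (u + v)\<close> are opposite
  numbers.\<close>
lemma separating_angle:
  assumes "cross2 u v \<noteq> 0"
  obtains \<theta> where "offset \<theta> u * offset \<theta> v < 0"
proof -
  obtain r \<theta> where polar: "(u + v) $ 1 = r * cos \<theta>" "(u + v) $ 2 = r * sin \<theta>"
    using polar_Ex by metis
  have "r * offset \<theta> u = cross2 u v" "r * offset \<theta> v = - cross2 u v"
    unfolding offset_polar[OF polar] by (simp_all add: cross2_def algebra_simps)
  then have "(r * offset \<theta> u) * (r * offset \<theta> v) = - (cross2 u v)\<^sup>2"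
    by (simp add: power2_eq_square)
  then have "r\<^sup>2 * (offset \<theta> u * offset \<theta> v) = - (cross2 u v)\<^sup>2"
    by (simp add: power2_eq_square mult_ac)
  also have "\<dots> < 0"
    using assms by simp
  finally have "offset \<theta> u * offset \<theta> v < 0"
    by (metis not_less mult_nonneg_nonneg zero_le_power2)
  then show thesis
    by (rule that)
qed

text \<open>A line through \<open>p\<close> that separates two points of the curve meets the connected punctured
  curve.\<close>
lemma separating_angle_not_special:
  assumes "jordan_curve \<gamma>" "a \<in> curve_image \<gamma>" "b \<in> curve_image \<gamma>"
    and sep: "offset \<theta> (a - p) * offset \<theta> (b - p) < 0"
  shows "\<not> special_corner_of_angle \<gamma> \<theta> p"
proof
  assume special: "special_corner_of_angle \<gamma> \<theta> p"
  let ?S = "curve_image \<gamma> - {p}" and ?f = "\<lambda>q. offset \<theta> (q - p)"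
  have "connected (?f ` ?S)"
    using assms(1) special
    by (intro connected_continuous_image continuous_on_offset connected_punctured_jordan_curve)
       (auto simp: special_corner_of_angle_def)
  moreover have "a \<noteq> p" "b \<noteq> p"
    using sep by (auto simp: offset_def)
  then have "?f a \<in> ?f ` ?S" "?f b \<in> ?f ` ?S"
    using assms(2,3) by auto
  moreover have "?f a \<le> 0 \<and> 0 \<le> ?f b \<or> ?f b \<le> 0 \<and> 0 \<le> ?f a"
    using sep by (auto simp: mult_less_0_iff)
  ultimately have "0 \<in> ?f ` ?S"
    unfolding connected_iff_interval by blast
  then obtain q where "q \<in> ?S" "0 = ?f q"
    by (rule imageE)
  then have "q \<in> line_through \<theta> p"
    by (simp add: mem_line_through_iff)
  with \<open>q \<in> ?S\<close> have "q \<in> line_through \<theta> p \<inter> curve_image \<gamma>" "q \<noteq> p"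
    by auto
  then show False
    using special by (auto simp: special_corner_of_angle_def)
qed

theorem proposition1p7:
  fixes \<gamma> :: "complex \<Rightarrow> real ^ 2"
  assumes "jordan_curve \<gamma>"
    and "\<exists>!p. special_corner \<gamma> p"
  shows "\<exists>\<theta>\<^sub>0 \<epsilon>. \<epsilon> > 0 \<and>
    (\<forall>\<theta> \<in> {\<theta>\<^sub>0 - \<epsilon> <..< \<theta>\<^sub>0 + \<epsilon>}. \<not> (\<exists>p. special_corner_of_angle \<gamma> \<theta> p))"
proof -
  obtain p where unique: "\<And>q \<theta>. special_corner_of_angle \<gamma> \<theta> q \<Longrightarrow> q = p"
    using assms(2) by (auto simp: special_corner_def)
  obtain a b where ab: "a \<in> curve_image \<gamma>" "b \<in> curve_image \<gamma>" "cross2 (a - p) (b - p) \<noteq> 0"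
    using jordan_curve_not_collinear[OF assms(1)] .
  define T where "T = {\<theta>. offset \<theta> (a - p) * offset \<theta> (b - p) < 0}"
  obtain \<theta>\<^sub>0 where "\<theta>\<^sub>0 \<in> T"
    using separating_angle[OF ab(3)] by (auto simp: T_def)
  moreover have "open T"
    unfolding T_def offset_def by (intro open_Collect_less continuous_intros)
  ultimately obtain \<epsilon> where "\<epsilon> > 0" "ball \<theta>\<^sub>0 \<epsilon> \<subseteq> T"
    using open_contains_ball by blast
  moreover have "\<not> special_corner_of_angle \<gamma> \<theta> q" if "\<theta> \<in> T" for \<theta> q
    using that unique separating_angle_not_special[OF assms(1) ab(1,2)] unfolding T_def by blast
  ultimately show ?thesis
    by (metis ball_eq_greaterThanLessThan subsetD)
qed

end
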